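(* Let $m\ge 1$ and let $a_1,\dots,a_m,c_1,\dots,c_m\in\mathbb{R}$ satisfy $a_i\le c_i$ for all $i=1,\dots,m$ and $c_i<a_{i+1}$ for all $i=1,\dots,m-1$ (equality $a_i=c_i$ is allowed). Put $b_i:=\frac{a_i+c_i}{2}$ for $i=1,\dots,m$. Define matrices $A,B\in\mathbb{R}^{2\times 3m}$ blockwise as follows: for each $i=1,\dots,m$, the columns numbered $3i-2,\,3i-1,\,3i$ of $A$ and of $B$ form, respectively, the $2\times 3$ blocks $$\begin{pmatrix} a_i & b_i & c_i\\ 2a_i & 2b_i & 2c_i\end{pmatrix}\qquad\text{and}\qquad \begin{pmatrix} 0&0&0\\ a_i & c_i & b_i\end{pmatrix},$$ where $2a_i,2b_i,2c_i$ denote the usual real products. Then the spectrum of the two-sided max-algebraic eigenproblem $A\otimes x=\lambda\otimes B\otimes x$ is $$\sigma(A,B)=\bigcup_{i=1}^m [a_i,c_i].$$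
   Context: Max algebra: $\overline{\mathbb{R}}=\mathbb{R}\cup\{-\infty\}$ is equipped with $a\oplus b:=\max(a,b)$ and $a\otimes b:=a+b$ (with $-\infty+a=a+(-\infty)=-\infty$ for all $a\in\overline{\mathbb{R}}$). For $A\in\overline{\mathbb{R}}^{n\times m}$ and $x\in\overline{\mathbb{R}}^m$, $(A\otimes x)_i=\max_{1\le j\le m}(a_{ij}+x_j)$; for $\lambda\in\overline{\mathbb{R}}$ and a vector or matrix $M$, $\lambda\otimes M$ is obtained by adding $\lambda$ to every entry of $M$. For $A,B\in\overline{\mathbb{R}}^{n\times m}$, the spectrum $\sigma(A,B)$ is the set of all $\lambda\in\overline{\mathbb{R}}$ for which there exists $x\in\overline{\mathbb{R}}^m$ with at least one finite entry (i.e. at least one entry different from $-\infty$) such that $A\otimes x=\lambda\otimes B\otimes x$. *)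

theory Defs
  imports Complex_Main "HOL-Library.Extended_Real" "Jordan_Normal_Form.Matrix"
begin

text \<open>
  The max-plus semiring is the set of extended reals different from \<open>\<infinity>\<close>. On this set addition
  of \<^typ>\<open>ereal\<close> satisfies \<open>-\<infinity> + a = a + -\<infinity> = -\<infinity>\<close>. Matrix and vector indices
  start at 0.
\<close>

definition maxplus :: "ereal set" where
  "maxplus = {u. u \<noteq> \<infinity>}"

definition mp_mult_mat_vec :: "ereal mat \<Rightarrow> ereal vec \<Rightarrow> ereal vec" (infixl "\<otimes>\<^sub>m\<^sub>p" 70) where
  "A \<otimes>\<^sub>m\<^sub>p x = vec (dim_row A) (\<lambda>i. Max ((\<lambda>j. A $$ (i, j) + x $ j) ` {..<dim_col A}))"

definition mp_smult_vec :: "ereal \<Rightarrow> ereal vec \<Rightarrow> ereal vec" where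
  "mp_smult_vec l v = map_vec (\<lambda>u. l + u) v"

text \<open>
  Meant for \<open>A\<close> and \<open>B\<close> of the same dimensions and with entries in \<^const>\<open>maxplus\<close>.
\<close>

definition mp_spectrum :: "ereal mat \<Rightarrow> ereal mat \<Rightarrow> ereal set" where
  "mp_spectrum A B = {l \<in> maxplus. \<exists>x \<in> carrier_vec (dim_col A).
     set\<^sub>v x \<subseteq> maxplus \<and> (\<exists>j < dim_col A. x $ j \<noteq> -\<infinity>) \<and>
     A \<otimes>\<^sub>m\<^sub>p x = mp_smult_vec l (B \<otimes>\<^sub>m\<^sub>p x)}"

definition block_A :: "real \<Rightarrow> real \<Rightarrow> real \<Rightarrow> real mat" where
  "block_A a b c = mat_of_rows_list 3 [[a, b, c], [2 * a, 2 * b, 2 * c]]"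

definition block_B :: "real \<Rightarrow> real \<Rightarrow> real \<Rightarrow> real mat" where
  "block_B a b c = mat_of_rows_list 3 [[0, 0, 0], [a, c, b]]"

text \<open>
  Juxtaposition of the \<open>2 \<times> 3\<close> blocks \<open>M 1, \<dots>, M m\<close>: the 0-based column \<open>k\<close> is column
  \<open>k mod 3\<close> of the block number \<open>k div 3 + 1\<close>.
\<close>

definition block_row :: "nat \<Rightarrow> (nat \<Rightarrow> real mat) \<Rightarrow> real mat" where
  "block_row m M = mat 2 (3 * m) (\<lambda>(r, k). M (k div 3 + 1) $$ (r, k mod 3))"

end

theory Submission
  imports Defs
begin

text \<open>
  Column \<open>k\<close> has the form \<open>(p, 2p)\<close> in \<open>A\<close> and \<open>(0, q)\<close> in \<open>B\<close>. If \<open>\<lambda>\<close> is an eigenvalue with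
  eigenvector \<open>x\<close>, let \<open>k\<close> attain the maximum in the first row of \<open>A \<otimes> x\<close> and \<open>j\<close> the maximum in
  the second row of \<open>B \<otimes> x\<close>. The first row gives \<open>p\<^sub>k \<ge> \<lambda>\<close>, and comparing the second row at \<open>k\<close> and
  \<open>j\<close> gives \<open>q\<^sub>j \<ge> p\<^sub>k \<ge> \<lambda>\<close>. If \<open>\<lambda>\<close> lies in no interval, then the block of \<open>j\<close> lies strictly above
  \<open>\<lambda>\<close>, so \<open>2p\<^sub>j > \<lambda> + q\<^sub>j\<close>, which contradicts the choice of \<open>j\<close>. Conversely, for
  \<open>\<lambda> \<in> [a\<^sub>i, c\<^sub>i]\<close> the vector that is \<open>(max 0 (b\<^sub>i - \<lambda>), 0, \<lambda> - c\<^sub>i)\<close> on block \<open>i\<close> and \<open>-\<infinity>\<close>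
  elsewhere is an eigenvector.
\<close>

text \<open>Trades vectors for plain functions on indices, of which only the values below
  \<open>d\<close> matter, and the vector equation for one equation between maxima per row.\<close>

lemma mp_spectrum_iff:
  assumes "A \<in> carrier_mat n d" and "B \<in> carrier_mat n d"
  shows "l \<in> mp_spectrum A B \<longleftrightarrow> l \<in> maxplus \<and>
    (\<exists>x. (\<forall>j<d. x j \<noteq> \<infinity>) \<and> (\<exists>j<d. x j \<noteq> -\<infinity>) \<and>
      (\<forall>i<n. Max ((\<lambda>j. A $$ (i, j) + x j) ` {..<d}) =
        l + Max ((\<lambda>j. B $$ (i, j) + x j) ` {..<d})))"
  (is "_ \<longleftrightarrow> _ \<and> (\<exists>x. ?P x)")
proof -
  have dims: "dim_row A = n" "dim_col A = d" "dim_row B = n" "dim_col B = d"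
    using assms by auto
  have forward: "?P (\<lambda>j. x $ j)" if "x \<in> carrier_vec d" "set\<^sub>v x \<subseteq> maxplus" "\<exists>j<d. x $ j \<noteq> -\<infinity>"
    "A \<otimes>\<^sub>m\<^sub>p x = mp_smult_vec l (B \<otimes>\<^sub>m\<^sub>p x)" for x
  proof (intro conjI allI impI)
    show "x $ j \<noteq> \<infinity>" if "j < d" for j
    proof -
      have "x $ j \<in> set\<^sub>v x"
        using \<open>x \<in> carrier_vec d\<close> that by (intro vec_setI) simp_all
      then show ?thesis
        using \<open>set\<^sub>v x \<subseteq> maxplus\<close> unfolding maxplus_def by blast
    qed
    show "Max ((\<lambda>j. A $$ (i, j) + x $ j) ` {..<d}) = l + Max ((\<lambda>j. B $$ (i, j) + x $ j) ` {..<d})"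
      if "i < n" for i
      using arg_cong[OF \<open>A \<otimes>\<^sub>m\<^sub>p x = mp_smult_vec l (B \<otimes>\<^sub>m\<^sub>p x)\<close>, of "\<lambda>v. v $ i"] that dims
      by (simp add: mp_mult_mat_vec_def mp_smult_vec_def)
  qed (fact that(3))
  have backward: "vec d x \<in> carrier_vec d \<and> set\<^sub>v (vec d x) \<subseteq> maxplus \<and>
      (\<exists>j<d. vec d x $ j \<noteq> -\<infinity>) \<and> A \<otimes>\<^sub>m\<^sub>p vec d x = mp_smult_vec l (B \<otimes>\<^sub>m\<^sub>p vec d x)"
    if x: "?P x" for x
  proof (intro conjI)
    show "set\<^sub>v (vec d x) \<subseteq> maxplus"
      using conjunct1[OF x] by (auto simp: maxplus_def elim!: vec_setE)
    show "A \<otimes>\<^sub>m\<^sub>p vec d x = mp_smult_vec l (B \<otimes>\<^sub>m\<^sub>p vec d x)"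
    proof (rule eq_vecI)
      have eq: "(\<lambda>j. C $$ (i, j) + vec d x $ j) ` {..<d} = (\<lambda>j. C $$ (i, j) + x j) ` {..<d}"
        for C :: "ereal mat" and i
        by (rule image_cong) auto
      show "(A \<otimes>\<^sub>m\<^sub>p vec d x) $ i = mp_smult_vec l (B \<otimes>\<^sub>m\<^sub>p vec d x) $ i"
        if "i < dim_vec (mp_smult_vec l (B \<otimes>\<^sub>m\<^sub>p vec d x))" for i
      proof -
        have "i < n"
          using that by (simp add: mp_mult_mat_vec_def mp_smult_vec_def dims)
        then have "Max ((\<lambda>j. A $$ (i, j) + x j) ` {..<d}) =
            l + Max ((\<lambda>j. B $$ (i, j) + x j) ` {..<d})"
          using x by blast
        then show ?thesis
          using \<open>i < n\<close> by (simp add: mp_mult_mat_vec_def mp_smult_vec_def dims eq)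
      qed
    qed (simp add: mp_mult_mat_vec_def mp_smult_vec_def dims)
    show "\<exists>j<d. vec d x $ j \<noteq> -\<infinity>"
      using x index_vec by metis
  qed simp
  have "(\<exists>x\<in>carrier_vec d. set\<^sub>v x \<subseteq> maxplus \<and> (\<exists>j<d. x $ j \<noteq> -\<infinity>) \<and>
      A \<otimes>\<^sub>m\<^sub>p x = mp_smult_vec l (B \<otimes>\<^sub>m\<^sub>p x)) \<longleftrightarrow> (\<exists>x. ?P x)" (is "?L \<longleftrightarrow> ?R")
  proof
    assume ?L
    then show ?R
      by (elim bexE conjE) (rule exI, rule forward)
  next
    assume ?R
    then obtain x where x: "?P x" ..
    show ?L
      using backward[OF x] by (intro bexI[of _ "vec d x"]) simp_all
  qed
  then show ?thesis
    by (simp only: mp_spectrum_def dims mem_Collect_eq)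
qed

text \<open>\<open>gap\<close> is the form in which an \<open>r\<close> outside all intervals
  enters: blocks below \<open>r\<close> satisfy it vacuously, blocks above \<open>r\<close> by the
  choice of \<open>b\<close> as midpoint. Arbitrary \<open>p\<close> and \<open>q\<close> keep the
  argument free of column arithmetic.\<close>

lemma no_eigenvector:
  fixes x :: "nat \<Rightarrow> ereal" and p q :: "nat \<Rightarrow> real" and r :: real
  assumes x: "\<And>j. j < d \<Longrightarrow> x j \<noteq> \<infinity>" and "k0 < d" "x k0 \<noteq> -\<infinity>"
    and row0: "Max ((\<lambda>j. ereal (p j) + x j) ` {..<d}) = ereal r + Max (x ` {..<d})"
    and row1: "Max ((\<lambda>j. ereal (2 * p j) + x j) ` {..<d}) =
      ereal r + Max ((\<lambda>j. ereal (q j) + x j) ` {..<d})"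
    and gap: "\<And>j. j < d \<Longrightarrow> r \<le> p j \<or> r \<le> q j \<Longrightarrow> r < p j \<and> r + q j < 2 * p j"
  shows False
proof -
  have attained: "\<exists>j<d. f j = Max (f ` {..<d})" for f :: "nat \<Rightarrow> ereal"
  proof -
    have "Max (f ` {..<d}) \<in> f ` {..<d}"
      using \<open>k0 < d\<close> by (intro Max_in) auto
    then show ?thesis by (metis imageE lessThan_iff)
  qed
  have upper: "f j \<le> Max (f ` {..<d})" if "j < d" for f :: "nat \<Rightarrow> ereal" and j
    using that by simp
  obtain k where k: "k < d" "ereal (p k) + x k = ereal r + Max (x ` {..<d})"
    using attained[of "\<lambda>j. ereal (p j) + x j"] row0 by auto
  obtain j where j: "j < d" "ereal (q j) + x j = Max ((\<lambda>j. ereal (q j) + x j) ` {..<d})"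
    using attained[of "\<lambda>j. ereal (q j) + x j"] by auto
  have "x k0 \<le> Max (x ` {..<d})" "x k \<le> Max (x ` {..<d})" "x j \<le> Max (x ` {..<d})"
    using upper[of _ x] \<open>k0 < d\<close> k j by auto
  \<comment> \<open>The maximum is finite: it dominates \<open>x k0\<close>, and it is attained at
    an entry different from \<infinity>.\<close>
  then obtain M where M: "Max (x ` {..<d}) = ereal M" "x k \<le> ereal M" "x j \<le> ereal M"
    using attained[of x] x \<open>x k0 \<noteq> -\<infinity>\<close>
    by (cases "Max (x ` {..<d})") auto
  obtain u where u: "x k = ereal u" "p k + u = r + M" "u \<le> M"
    using k M by (cases "x k") auto
  have row1_le: "ereal (2 * p i) + x i \<le> ereal r + (ereal (q j) + x j)" if "i < d" for i
    using upper[OF that, of "\<lambda>j. ereal (2 * p j) + x j"] row1 j by simp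
  \<comment> \<open>An infinite \<open>x j\<close> would force the finite left side of
    \<open>row1_le\<close> at \<open>k\<close> below -\<infinity>.\<close>
  obtain v where v: "x j = ereal v" "v \<le> M"
    using row1_le[OF k(1)] u M by (cases "x j") auto
  have "2 * p k + u \<le> r + (q j + v)"
    using row1_le[OF k(1)] u v by simp
  \<comment> \<open>Inserting \<open>u = r + M - p k\<close> gives
    \<open>p k + M \<le> q j + v\<close>. Since \<open>v \<le> M\<close>, this yields
    \<open>q j \<ge> p k\<close>, and \<open>u \<le> M\<close> gives
    \<open>p k \<ge> r\<close>.\<close>
  then have "r \<le> q j"
    using u v gap[OF k(1)] by linarith
  then have "r + q j < 2 * p j"
    using gap[OF j(1)] by blast
  moreover have "2 * p j + v \<le> r + (q j + v)"
    using row1_le[OF j(1)] v by simp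
  ultimately show False by simp
qed

lemma nat_cases_mod_3:
  fixes k :: nat
  obtains h where "k = 3 * h" | h where "k = 3 * h + 1" | h where "k = 3 * h + 2"
proof -
  have "k = 3 * (k div 3) \<or> k = 3 * (k div 3) + 1 \<or> k = 3 * (k div 3) + 2"
    by presburger
  then show ?thesis using that by blast
qed

theorem theorem3p1:
  fixes m :: nat and a b c :: "nat \<Rightarrow> real" and A B :: "real mat"
  assumes "m \<ge> 1"
    and "\<And>i. i \<in> {1..m} \<Longrightarrow> a i \<le> c i"
    and "\<And>i. i \<in> {1..<m} \<Longrightarrow> c i < a (i + 1)"
    and "\<And>i. i \<in> {1..m} \<Longrightarrow> b i = (a i + c i) / 2"
    and "A = block_row m (\<lambda>i. block_A (a i) (b i) (c i))"
    and "B = block_row m (\<lambda>i. block_B (a i) (b i) (c i))"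
  shows "mp_spectrum (map_mat ereal A) (map_mat ereal B) = ereal ` (\<Union>i\<in>{1..m}. {a i..c i})"
proof -
  define d where "d = 3 * m"
  \<comment> \<open>Columns count from 0 and blocks from 1, hence the shift. The lists of
    \<open>p\<close> and \<open>q\<close> differ by exchanging \<open>b\<close> and
    \<open>c\<close>.\<close>
  define p where "p k = [a (k div 3 + 1), b (k div 3 + 1), c (k div 3 + 1)] ! (k mod 3)" for k
  define q where "q k = [a (k div 3 + 1), c (k div 3 + 1), b (k div 3 + 1)] ! (k mod 3)" for k
  have pq: "p (3 * h) = a (h + 1)" "p (3 * h + 1) = b (h + 1)" "p (3 * h + 2) = c (h + 1)"
    "q (3 * h) = a (h + 1)" "q (3 * h + 1) = c (h + 1)" "q (3 * h + 2) = b (h + 1)" for h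
  proof -
    have "(3 * h + 1) div 3 = h" "(3 * h + 1) mod 3 = 1" "(3 * h + 2) div 3 = h" "(3 * h + 2) mod 3 = 2"
      by presburger+
    then show "p (3 * h) = a (h + 1)" "p (3 * h + 1) = b (h + 1)" "p (3 * h + 2) = c (h + 1)"
      "q (3 * h) = a (h + 1)" "q (3 * h + 1) = c (h + 1)" "q (3 * h + 2) = b (h + 1)"
      unfolding p_def q_def by simp_all
  qed
  have block: "a (h + 1) \<le> c (h + 1)" "b (h + 1) = (a (h + 1) + c (h + 1)) / 2" if "h < m" for h
    using that assms(2,4)[of "h + 1"] by auto
  have entries: "map_mat ereal A $$ (0, k) = ereal (p k)"
    "map_mat ereal A $$ (1, k) = ereal (2 * p k)"
    "map_mat ereal B $$ (0, k) = 0" "map_mat ereal B $$ (1, k) = ereal (q k)" if "k < d" for k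
  proof -
    have "k mod 3 = 0 \<or> k mod 3 = 1 \<or> k mod 3 = 2"
      by presburger
    then show "map_mat ereal A $$ (0, k) = ereal (p k)"
      "map_mat ereal A $$ (1, k) = ereal (2 * p k)"
      "map_mat ereal B $$ (0, k) = 0" "map_mat ereal B $$ (1, k) = ereal (q k)"
      using that
      by (auto simp: assms(5,6) d_def block_row_def block_A_def block_B_def
        mat_of_rows_list_def p_def q_def zero_ereal_def)
  qed
  have carrier: "map_mat ereal A \<in> carrier_mat 2 d" "map_mat ereal B \<in> carrier_mat 2 d"
    by (simp_all add: assms(5,6) d_def block_row_def)
  have images: "(\<lambda>k. map_mat ereal A $$ (0, k) + x k) ` {..<d} = (\<lambda>k. ereal (p k) + x k) ` {..<d}"
    "(\<lambda>k. map_mat ereal A $$ (1, k) + x k) ` {..<d} = (\<lambda>k. ereal (2 * p k) + x k) ` {..<d}"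
    "(\<lambda>k. map_mat ereal B $$ (0, k) + x k) ` {..<d} = x ` {..<d}"
    "(\<lambda>k. map_mat ereal B $$ (1, k) + x k) ` {..<d} = (\<lambda>k. ereal (q k) + x k) ` {..<d}" for x
    using entries by (simp_all cong: image_cong_simp del: index_map_mat)
  have all_less_2: "(\<forall>i<2. P i) \<longleftrightarrow> P 0 \<and> P 1" for P :: "nat \<Rightarrow> bool"
    by (auto simp: less_2_cases_iff)
  have spectrum: "l \<in> mp_spectrum (map_mat ereal A) (map_mat ereal B) \<longleftrightarrow> l \<noteq> \<infinity> \<and>
    (\<exists>x. (\<forall>k<d. x k \<noteq> \<infinity>) \<and> (\<exists>k<d. x k \<noteq> -\<infinity>) \<and>
      Max ((\<lambda>k. ereal (p k) + x k) ` {..<d}) = l + Max (x ` {..<d}) \<and>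
      Max ((\<lambda>k. ereal (2 * p k) + x k) ` {..<d}) =
        l + Max ((\<lambda>k. ereal (q k) + x k) ` {..<d}))" for l
    unfolding mp_spectrum_iff[OF carrier] all_less_2 images maxplus_def by simp
  show ?thesis
  proof (intro equalityI subsetI)
    fix l assume "l \<in> mp_spectrum (map_mat ereal A) (map_mat ereal B)"
    then obtain x k0 where x: "l \<noteq> \<infinity>" "\<And>k. k < d \<Longrightarrow> x k \<noteq> \<infinity>" "k0 < d" "x k0 \<noteq> -\<infinity>"
      and row0: "Max ((\<lambda>k. ereal (p k) + x k) ` {..<d}) = l + Max (x ` {..<d})"
      and row1: "Max ((\<lambda>k. ereal (2 * p k) + x k) ` {..<d}) =
        l + Max ((\<lambda>k. ereal (q k) + x k) ` {..<d})"
      unfolding spectrum by blast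
    \<comment> \<open>Otherwise row 0 would have maximum -\<infinity>, although column
      \<open>k0\<close> contributes a finite term. The maximum of \<open>x\<close> must first be
      kept from \<infinity>, because -\<infinity> + \<infinity> = \<infinity> in
      \<open>ereal\<close>.\<close>
    have "l \<noteq> -\<infinity>"
    proof
      assume "l = -\<infinity>"
      have "Max (x ` {..<d}) \<in> x ` {..<d}"
        using \<open>k0 < d\<close> by (intro Max_in) auto
      then have "Max (x ` {..<d}) \<noteq> \<infinity>"
        using x(2) by (metis imageE lessThan_iff)
      moreover have "-\<infinity> + y = -\<infinity>" if "y \<noteq> \<infinity>" for y :: ereal
        using that by (cases y) auto
      ultimately have "Max ((\<lambda>k. ereal (p k) + x k) ` {..<d}) = -\<infinity>"
        using row0 \<open>l = -\<infinity>\<close> by metis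
      moreover have "ereal (p k0) + x k0 \<le> Max ((\<lambda>k. ereal (p k) + x k) ` {..<d})"
        using \<open>k0 < d\<close> by simp
      ultimately show False
        using x(4) by (cases "x k0") simp_all
    qed
    then obtain r where l: "l = ereal r"
      using x(1) by (cases l) auto
    have "\<exists>i\<in>{1..m}. a i \<le> r \<and> r \<le> c i"
    proof (rule ccontr)
      assume outside: "\<not> (\<exists>i\<in>{1..m}. a i \<le> r \<and> r \<le> c i)"
      have out: "r < a (h + 1) \<or> c (h + 1) < r" if "h < m" for h
        using that outside by (auto simp: not_le)
      \<comment> \<open>If \<open>c < r\<close>, neither \<open>p\<close> nor \<open>q\<close>
        reaches \<open>r\<close> in the block. If \<open>r < a\<close>, then \<open>2p - q\<close>
        takes the values \<open>a\<close>, \<open>2b - c = a\<close> and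
        \<open>2c - b \<ge> c\<close> on its three columns, all above \<open>r\<close>.\<close>
      have "r < p k \<and> r + q k < 2 * p k" if "k < d" "r \<le> p k \<or> r \<le> q k" for k
      proof (cases k rule: nat_cases_mod_3)
        case (1 h)
        then show ?thesis using that pq block[of h] out[of h] by (auto simp: d_def)
      next
        case (2 h)
        then show ?thesis using that pq[of h] block[of h] out[of h] by (auto simp: d_def)
      next
        case (3 h)
        then show ?thesis using that pq[of h] block[of h] out[of h] by (auto simp: d_def)
      qed
      then show False
        using no_eigenvector[OF x(2-4) row0[unfolded l] row1[unfolded l]] by blast
    qed
    then show "l \<in> ereal ` (\<Union>i\<in>{1..m}. {a i..c i})"
      using l by auto
  next
    fix l assume "l \<in> ereal ` (\<Union>i\<in>{1..m}. {a i..c i})"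
    then obtain i r where ir: "i \<in> {1..m}" "a i \<le> r" "r \<le> c i" "l = ereal r"
      by auto
    define h where "h = i - 1"
    have h: "h < m" "h + 1 = i" "a (h + 1) \<le> r" "r \<le> c (h + 1)"
      using ir by (auto simp: h_def)
    \<comment> \<open>The second column contributes \<open>b\<close> to row 0 of the left side,
      which exceeds \<open>r\<close> when \<open>r < b\<close>. The first entry \<open>s\<close>
      raises the right side to \<open>r + s\<close>, just enough to absorb this.\<close>
    define s where "s = max 0 (b (h + 1) - r)"
    define x where "x k = (if k = 3 * h then ereal s else if k = 3 * h + 1 then 0
      else if k = 3 * h + 2 then ereal (r - c (h + 1)) else -\<infinity>)" for k
    have s: "0 \<le> s" "b (h + 1) - r \<le> s" "s = 0 \<or> s = b (h + 1) - r"
      by (auto simp: s_def)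
    note bnd = h(3,4) block[OF h(1)] s
    \<comment> \<open>Columns outside the block contribute -\<infinity>, so three upper bounds and
      one equality certify a maximum. This serves all four row maxima.\<close>
    have Max_x: "Max ((\<lambda>k. ereal (w k) + x k) ` {..<d}) = ereal t"
      if "w (3 * h) + s \<le> t" "w (3 * h + 1) \<le> t" "w (3 * h + 2) + (r - c (h + 1)) \<le> t"
        "w (3 * h) + s = t \<or> w (3 * h + 1) = t \<or> w (3 * h + 2) + (r - c (h + 1)) = t" for w t
    proof (rule Max_eqI)
      fix y assume "y \<in> (\<lambda>k. ereal (w k) + x k) ` {..<d}"
      then obtain k where "y = ereal (w k) + x k"
        by blast
      then show "y \<le> ereal t"
        using that(1-3) by (simp add: x_def)
    next
      have terms: "ereal (w (3 * h) + s) = ereal (w (3 * h)) + x (3 * h)"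
        "ereal (w (3 * h + 1)) = ereal (w (3 * h + 1)) + x (3 * h + 1)"
        "ereal (w (3 * h + 2) + (r - c (h + 1))) = ereal (w (3 * h + 2)) + x (3 * h + 2)"
        by (simp_all add: x_def)
      have "3 * h \<in> {..<d}" "3 * h + 1 \<in> {..<d}" "3 * h + 2 \<in> {..<d}"
        using h(1) by (auto simp: d_def)
      note this[THEN imageI[where f = "\<lambda>k. ereal (w k) + x k"]]
      then show "ereal t \<in> (\<lambda>k. ereal (w k) + x k) ` {..<d}"
        unfolding terms[symmetric] using that(4) by metis
    qed simp
    \<comment> \<open>Attained in the third column if \<open>s = 0\<close>, and in the second if
      \<open>s = b - r\<close>.\<close>
    have "Max ((\<lambda>k. ereal (p k) + x k) ` {..<d}) = ereal (r + s)"
      by (rule Max_x; unfold pq) (use bnd in argo)+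
    moreover have "Max ((\<lambda>k. ereal 0 + x k) ` {..<d}) = ereal s"
      by (rule Max_x) (use bnd in argo)+
    then have "Max (x ` {..<d}) = ereal s"
      by (simp only: flip: zero_ereal_def) simp
    \<comment> \<open>Attained in the third column, whose entry \<open>r - c\<close> turns
      \<open>2c\<close> into \<open>r + c\<close>; the second column stays below since
      \<open>2b = a + c \<le> r + c\<close>. The matching value \<open>c\<close> for
      \<open>q\<close> comes from the second column.\<close>
    moreover have "Max ((\<lambda>k. ereal (2 * p k) + x k) ` {..<d}) = ereal (r + c (h + 1))"
      by (rule Max_x; unfold pq) (use bnd in argo)+
    moreover have "Max ((\<lambda>k. ereal (q k) + x k) ` {..<d}) = ereal (c (h + 1))"
      by (rule Max_x; unfold pq) (use bnd in argo)+
    moreover have "3 * h < d" "x (3 * h) \<noteq> -\<infinity>" "\<forall>k<d. x k \<noteq> \<infinity>"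
      using h(1) by (auto simp: x_def d_def)
    ultimately show "l \<in> mp_spectrum (map_mat ereal A) (map_mat ereal B)"
      unfolding spectrum ir(4) by (intro conjI exI[of _ x] exI[of _ "3 * h"]) simp_all
  qed
qed

end
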